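(* Let $K$ be a field, $E$ a (row-finite) directed graph, and let $p$ and $q$ be right-infinite paths in $E$. Then: (i) The Chen module $V_{[p]}$ is a simple $L_K(E)$-module. (ii) The $L_K(E)$-modules $V_{[p]}$ and $V_{[q]}$ are isomorphic if and only if $[p]=[q]$. (iii) The $L_K(E)$-module $V_{[p]}$ is graded if and only if $p$ is an irrational infinite path.
   Context: A directed graph $E=(E^0,E^1,r,s)$ consists of sets $E^0,E^1$ and maps $r,s:E^1\to E^0$ (range, source); row-finite means $s^{-1}(v)$ is finite for every $v\in E^0$. The Leavitt path algebra $L_K(E)$ is the (not necessarily unital) $K$-algebra generated by $\{v,e,e^*\mid v\in E^0,e\in E^1\}$ subject to $uv=\delta_{uv}u$ ($u,v\in E^0$); $s(e)e=e=er(e)$, $r(e)e^*=e^*=e^*s(e)$ ($e\in E^1$); $e^*f=\delta_{ef}r(e)$ for $e,f\in E^1$ with $s(e)=s(f)$; $\sum_{e\in s^{-1}(v)}ee^*=v$ for every $v\in E^0$ that is not a sink. It is $\mathbb Z$-graded with $\deg(v)=0$, $\deg(e)=1$, $\deg(e^* )=-1$. A right $L_K(E)$-module $V$ is called graded if it admits a decomposition $V=\bigoplus_{n\in\mathbb Z}V_n$ with $V_nL_K(E)_m\subseteq V_{n+m}$ for all $m,n$. A right-infinite path is a sequence $p=p_1p_2\cdots$ of edges with $r(p_i)=s(p_{i+1})$; $E^\infty$ is the set of these; $s(p)=s(p_1)$. For $n\ge0$, $\tau_{\le n}(p)=p_1\cdots p_n$ ($=s(p)$ if $n=0$) and $\tau_{>n}(p)=p_{n+1}p_{n+2}\cdots$.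 Two paths $p,q\in E^\infty$ are tail-equivalent if $\tau_{>m}(p)=\tau_{>n}(q)$ for some $m,n\ge0$; $[p]$ is the tail-equivalence class of $p$. $p$ is cyclic if $p=ccc\cdots$ for a finite closed path $c$; $p$ is rational if it is tail-equivalent to a cyclic path, and irrational otherwise. The Chen module $V_{[p]}$ is the $K$-vector space with basis the set $[p]$ and right $L_K(E)$-action determined, for $q\in[p]$, $v\in E^0$, $e\in E^1$, by: $q\cdot v=q$ if $v=s(q)$ and $0$ otherwise; $q\cdot e=\tau_{>1}(q)$ if $e=\tau_{\le1}(q)$ and $0$ otherwise; $q\cdot e^*=eq$ if $r(e)=s(q)$ and $0$ otherwise. *)

theory Defs
  imports
    "HOL-Library.Poly_Mapping"
    "HOL-Library.Stream"
    "HOL-Algebra.QuotRing"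
    "Graph_Theory.Digraph"
    "Graph_Theory.Arc_Walk"
begin

section \<open>Graphs and right-infinite paths\<close>

definition row_finite :: "('v, 'e) pre_digraph \<Rightarrow> bool" where
  "row_finite E \<longleftrightarrow> (\<forall>v \<in> verts E. finite (out_arcs E v))"

definition infinite_paths :: "('v, 'e) pre_digraph \<Rightarrow> 'e stream set" where
  "infinite_paths E =
     {p. sset p \<subseteq> arcs E \<and> (\<forall>i. head E (p !! i) = tail E (p !! Suc i))}"

definition tail_equivalent :: "'e stream \<Rightarrow> 'e stream \<Rightarrow> bool" where
  "tail_equivalent p q \<longleftrightarrow> (\<exists>m n. sdrop m p = sdrop n q)"

definition tail_class :: "('v, 'e) pre_digraph \<Rightarrow> 'e stream \<Rightarrow> 'e stream set" where
  "tail_class E p = {q \<in> infinite_paths E. tail_equivalent p q}"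

text \<open>\<^const>\<open>Stream.cycle\<close> repeats a nonempty list forever.\<close>

definition cyclic_path :: "('v, 'e) pre_digraph \<Rightarrow> 'e stream \<Rightarrow> bool" where
  "cyclic_path E p \<longleftrightarrow>
     (\<exists>c v. c \<noteq> [] \<and> pre_digraph.awalk E v c v \<and> p = Stream.cycle c)"

definition rational_path :: "('v, 'e) pre_digraph \<Rightarrow> 'e stream \<Rightarrow> bool" where
  "rational_path E p \<longleftrightarrow>
     p \<in> infinite_paths E \<and> (\<exists>q. cyclic_path E q \<and> tail_equivalent p q)"

definition irrational_path :: "('v, 'e) pre_digraph \<Rightarrow> 'e stream \<Rightarrow> bool" where
  "irrational_path E p \<longleftrightarrow> p \<in> infinite_paths E \<and> \<not> rational_path E p"


section \<open>Right modules over a ring that need not have a unit\<close>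

text \<open>The field \<open>one\<close> of the ring record \<open>R\<close>, and the fields \<open>mult\<close> and \<open>one\<close> of the module
  record, are never used.\<close>

record ('a, 'm) right_module = "'m ring" +
  ract :: "'m \<Rightarrow> 'a \<Rightarrow> 'm" (infixl \<open>\<cdot>\<index>\<close> 70)

locale right_module = M?: abelian_group M
  for R :: "('a, 'c) ring_scheme" and M :: "('a, 'm, 'd) right_module_scheme" (structure) +
  assumes ract_closed:
      "\<lbrakk>x \<in> carrier M; a \<in> carrier R\<rbrakk> \<Longrightarrow> x \<cdot> a \<in> carrier M"
    and ract_add_left:
      "\<lbrakk>x \<in> carrier M; y \<in> carrier M; a \<in> carrier R\<rbrakk> \<Longrightarrow> (x \<oplus> y) \<cdot> a = x \<cdot> a \<oplus> y \<cdot> a"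
    and ract_add_right:
      "\<lbrakk>x \<in> carrier M; a \<in> carrier R; b \<in> carrier R\<rbrakk>
        \<Longrightarrow> x \<cdot> (a \<oplus>\<^bsub>R\<^esub> b) = x \<cdot> a \<oplus> x \<cdot> b"
    and ract_mult:
      "\<lbrakk>x \<in> carrier M; a \<in> carrier R; b \<in> carrier R\<rbrakk>
        \<Longrightarrow> x \<cdot> (a \<otimes>\<^bsub>R\<^esub> b) = (x \<cdot> a) \<cdot> b"

definition submodule ::
  "('a, 'c) ring_scheme \<Rightarrow> ('a, 'm, 'd) right_module_scheme \<Rightarrow> 'm set \<Rightarrow> bool" where
  "submodule R M N \<longleftrightarrow>
     additive_subgroup N M \<and> (\<forall>x \<in> N. \<forall>a \<in> carrier R. x \<cdot>\<^bsub>M\<^esub> a \<in> N)"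

text \<open>Over a ring without unit, simplicity includes \<open>M R \<noteq> 0\<close>; in particular \<open>M \<noteq> 0\<close>.\<close>

definition simple_module ::
  "('a, 'c) ring_scheme \<Rightarrow> ('a, 'm, 'd) right_module_scheme \<Rightarrow> bool" where
  "simple_module R M \<longleftrightarrow>
     right_module R M \<and>
     (\<exists>x \<in> carrier M. \<exists>a \<in> carrier R. x \<cdot>\<^bsub>M\<^esub> a \<noteq> \<zero>\<^bsub>M\<^esub>) \<and>
     (\<forall>N. submodule R M N \<longrightarrow> N = {\<zero>\<^bsub>M\<^esub>} \<or> N = carrier M)"

definition isomorphic_modules ::
  "('a, 'c) ring_scheme \<Rightarrow> ('a, 'm, 'd) right_module_scheme \<Rightarrow>
     ('a, 'n, 'f) right_module_scheme \<Rightarrow> bool" where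
  "isomorphic_modules R M N \<longleftrightarrow>
     right_module R M \<and> right_module R N \<and>
     (\<exists>\<phi> \<in> iso (add_monoid M) (add_monoid N).
        \<forall>x \<in> carrier M. \<forall>a \<in> carrier R. \<phi> (x \<cdot>\<^bsub>M\<^esub> a) = \<phi> x \<cdot>\<^bsub>N\<^esub> a)"

text \<open>Here \<open>L m\<close> is the homogeneous component of degree \<open>m\<close> of the ring \<open>R\<close>.\<close>

definition graded_module ::
  "('a, 'c) ring_scheme \<Rightarrow> (int \<Rightarrow> 'a set) \<Rightarrow> ('a, 'm, 'd) right_module_scheme \<Rightarrow> bool" where
  "graded_module R L M \<longleftrightarrow>
     right_module R M \<and>
     (\<exists>V :: int \<Rightarrow> 'm set.
        (\<forall>n. additive_subgroup (V n) M) \<and>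
        (\<forall>x \<in> carrier M. \<exists>!f. (\<forall>n. f n \<in> V n) \<and> finite {n. f n \<noteq> \<zero>\<^bsub>M\<^esub>} \<and>
            x = (\<Oplus>\<^bsub>M\<^esub>n \<in> {n. f n \<noteq> \<zero>\<^bsub>M\<^esub>}. f n)) \<and>
        (\<forall>n m. \<forall>x \<in> V n. \<forall>a \<in> L m. x \<cdot>\<^bsub>M\<^esub> a \<in> V (n + m)))"


section \<open>Leavitt path algebras\<close>

datatype ('v, 'e) lpa_gen = Vertex 'v | Edge 'e | Ghost 'e

definition lpa_gens :: "('v, 'e) pre_digraph \<Rightarrow> ('v, 'e) lpa_gen set" where
  "lpa_gens E = Vertex ` verts E \<union> Edge ` arcs E \<union> Ghost ` arcs E"

text \<open>With concatenation as addition of words, the product of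
  \<^typ>\<open>'x list \<Rightarrow>\<^sub>0 'k\<close> is that of the free associative algebra.\<close>

instantiation list :: (type) monoid_add
begin
definition zero_list :: "'a list" where "0 = []"
definition plus_list :: "'a list \<Rightarrow> 'a list \<Rightarrow> 'a list" where "xs + ys = xs @ ys"
instance by standard (simp_all add: zero_list_def plus_list_def)
end

definition free_algebra ::
  "'k::field itself \<Rightarrow> 'x set \<Rightarrow> ('x list \<Rightarrow>\<^sub>0 'k) ring" where
  "free_algebra K X =
     \<lparr>carrier = {a. Poly_Mapping.keys a \<subseteq> lists X}, mult = (*), one = 1, zero = 0, add = (+)\<rparr>"

abbreviation word :: "'x list \<Rightarrow> ('x list \<Rightarrow>\<^sub>0 'k::field)" where
  "word w \<equiv> Poly_Mapping.single w 1"

definition lpa_relators ::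
  "'k::field itself \<Rightarrow> ('v, 'e) pre_digraph \<Rightarrow> (('v, 'e) lpa_gen list \<Rightarrow>\<^sub>0 'k) set" where
  "lpa_relators K E =
     {word [Vertex u, Vertex v] - (if u = v then word [Vertex u] else 0) | u v.
        u \<in> verts E \<and> v \<in> verts E} \<union>
     (\<Union>e \<in> arcs E.
       {word [Vertex (tail E e), Edge e] - word [Edge e],
        word [Edge e, Vertex (head E e)] - word [Edge e],
        word [Vertex (head E e), Ghost e] - word [Ghost e],
        word [Ghost e, Vertex (tail E e)] - word [Ghost e]}) \<union>
     {word [Ghost e, Edge f] - (if e = f then word [Vertex (head E e)] else 0) | e f.
        e \<in> arcs E \<and> f \<in> arcs E \<and> tail E e = tail E f} \<union>
     {(\<Sum>e \<in> out_arcs E v. word [Edge e, Ghost e]) - word [Vertex v] | v.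
        v \<in> verts E \<and> out_arcs E v \<noteq> {}}"

text \<open>The relators are combinations of nonempty words, and the ideal they generate in the unital
  free algebra equals the algebra ideal they generate in the non-unital free algebra (the span of
  the nonempty words). So the Leavitt path algebra is the quotient of the latter by this ideal,
  inside the quotient of the former. The record field \<open>one\<close> is a leftover from the unital
  quotient and in general does not lie in the carrier.\<close>

definition lpa_ideal ::
  "'k::field itself \<Rightarrow> ('v, 'e) pre_digraph \<Rightarrow> (('v, 'e) lpa_gen list \<Rightarrow>\<^sub>0 'k) set" where
  "lpa_ideal K E = genideal (free_algebra K (lpa_gens E)) (lpa_relators K E)"

definition lpa_class ::
  "'k::field itself \<Rightarrow> ('v, 'e) pre_digraph \<Rightarrow>
     (('v, 'e) lpa_gen list \<Rightarrow>\<^sub>0 'k) \<Rightarrow> (('v, 'e) lpa_gen list \<Rightarrow>\<^sub>0 'k) set" where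
  "lpa_class K E a = lpa_ideal K E +>\<^bsub>free_algebra K (lpa_gens E)\<^esub> a"

definition nonunital_free_algebra ::
  "'k::field itself \<Rightarrow> 'x set \<Rightarrow> ('x list \<Rightarrow>\<^sub>0 'k) set" where
  "nonunital_free_algebra K X = {a. Poly_Mapping.keys a \<subseteq> lists X - {[]}}"

definition leavitt_path_algebra ::
  "'k::field itself \<Rightarrow> ('v, 'e) pre_digraph \<Rightarrow> (('v, 'e) lpa_gen list \<Rightarrow>\<^sub>0 'k) set ring" where
  "leavitt_path_algebra K E =
     (free_algebra K (lpa_gens E) Quot lpa_ideal K E)
       \<lparr>carrier := lpa_class K E ` nonunital_free_algebra K (lpa_gens E)\<rparr>"

fun gen_degree :: "('v, 'e) lpa_gen \<Rightarrow> int" where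
  "gen_degree (Vertex v) = 0"
| "gen_degree (Edge e) = 1"
| "gen_degree (Ghost e) = - 1"

definition lpa_component ::
  "'k::field itself \<Rightarrow> ('v, 'e) pre_digraph \<Rightarrow> int \<Rightarrow> (('v, 'e) lpa_gen list \<Rightarrow>\<^sub>0 'k) set set" where
  "lpa_component K E n =
     lpa_class K E ` {a \<in> nonunital_free_algebra K (lpa_gens E).
       \<forall>w \<in> Poly_Mapping.keys a. sum_list (map gen_degree w) = n}"


section \<open>Chen modules\<close>

definition scale :: "'k::field \<Rightarrow> ('x \<Rightarrow>\<^sub>0 'k) \<Rightarrow> ('x \<Rightarrow>\<^sub>0 'k)" where
  "scale c f = Poly_Mapping.map ((*) c) f"

definition linear_extension ::
  "('x \<Rightarrow> ('y \<Rightarrow>\<^sub>0 'k::field)) \<Rightarrow> ('x \<Rightarrow>\<^sub>0 'k) \<Rightarrow> ('y \<Rightarrow>\<^sub>0 'k)" where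
  "linear_extension \<phi> f =
     (\<Sum>x \<in> Poly_Mapping.keys f. scale (Poly_Mapping.lookup f x) (\<phi> x))"

fun path_act ::
  "('v, 'e) pre_digraph \<Rightarrow> ('v, 'e) lpa_gen \<Rightarrow> 'e stream \<Rightarrow> ('e stream \<Rightarrow>\<^sub>0 'k::field)" where
  "path_act E (Vertex v) q =
     (if v = tail E (shd q) then Poly_Mapping.single q 1 else 0)"
| "path_act E (Edge e) q =
     (if e = shd q then Poly_Mapping.single (stl q) 1 else 0)"
| "path_act E (Ghost e) q =
     (if head E e = tail E (shd q) then Poly_Mapping.single (e ## q) 1 else 0)"

text \<open>Right action: the first letter of a word acts first.\<close>

definition word_act ::
  "('v, 'e) pre_digraph \<Rightarrow> ('e stream \<Rightarrow>\<^sub>0 'k::field) \<Rightarrow> ('v, 'e) lpa_gen list \<Rightarrow> ('e stream \<Rightarrow>\<^sub>0 'k)"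
  where "word_act E f w = fold (\<lambda>g. linear_extension (path_act E g)) w f"

definition free_act ::
  "('v, 'e) pre_digraph \<Rightarrow> ('e stream \<Rightarrow>\<^sub>0 'k::field) \<Rightarrow> (('v, 'e) lpa_gen list \<Rightarrow>\<^sub>0 'k) \<Rightarrow>
     ('e stream \<Rightarrow>\<^sub>0 'k)" where
  "free_act E f a = linear_extension (word_act E f) a"

text \<open>\<^const>\<open>the_elem\<close> picks the common value of \<^const>\<open>free_act\<close> on the representatives of a coset;
  that there is one is \<open>chen_module_act\<close> below.\<close>

definition chen_module ::
  "'k::field itself \<Rightarrow> ('v, 'e) pre_digraph \<Rightarrow> 'e stream \<Rightarrow>
     ((('v, 'e) lpa_gen list \<Rightarrow>\<^sub>0 'k) set, 'e stream \<Rightarrow>\<^sub>0 'k) right_module" where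
  "chen_module K E p =
     \<lparr>carrier = {f. Poly_Mapping.keys f \<subseteq> tail_class E p},
      mult = (\<lambda>_ _. 0), one = 0, zero = 0, add = (+),
      ract = (\<lambda>f A. the_elem (free_act E f ` A))\<rparr>"

section \<open>The action of the Leavitt path algebra is well defined\<close>

lemma lookup_scale:
  "Poly_Mapping.lookup (scale c f) x = (c :: 'k::field) * Poly_Mapping.lookup f x"
  by (simp add: scale_def Poly_Mapping.map.rep_eq when_def)

lemma scale_add: "scale (c :: 'k::field) (f + g) =
    scale c f + scale c g"
  by (rule poly_mapping_eqI) (simp add: lookup_scale lookup_add algebra_simps)

lemma scale_add_left: "scale (c + d :: 'k::field) f =
    scale c f + scale d f"
  by (rule poly_mapping_eqI) (simp add: lookup_scale lookup_add algebra_simps)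

lemma scale_scale: "scale (c :: 'k::field) (scale d f) =
    scale (c * d) f"
  by (rule poly_mapping_eqI) (simp add: lookup_scale)

lemma scale_0 [simp]: "scale (0 :: 'k::field) f = 0"
  by (rule poly_mapping_eqI) (simp add: lookup_scale)

lemma scale_zero [simp]: "scale (c :: 'k::field) 0 = 0"
  by (rule poly_mapping_eqI) (simp add: lookup_scale)

lemma scale_1 [simp]: "scale (1 :: 'k::field) f = f"
  by (rule poly_mapping_eqI) (simp add: lookup_scale)

lemma linear_extension_zero [simp]: "linear_extension \<phi> 0 = 0"
  by (simp add: linear_extension_def)

lemma linear_extension_single [simp]:
  "linear_extension \<phi> (Poly_Mapping.single x c) = scale c (\<phi> x)"
  by (cases "c = 0") (simp_all add: linear_extension_def)

lemma linear_extension_add: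
  "linear_extension \<phi> (f + g) = linear_extension \<phi> f + linear_extension \<phi> g"
  unfolding linear_extension_def
  by (rule setsum_keys_plus_distrib) (simp_all add: scale_add_left)

lemma linear_extension_diff:
  "linear_extension \<phi> (f - g) = linear_extension \<phi> f - linear_extension \<phi> g"
  using linear_extension_add[of \<phi> "f - g" g] by (simp add: algebra_simps)

lemma linear_extension_sum:
  "linear_extension \<phi> (\<Sum>i \<in> I. f i) = (\<Sum>i \<in> I. linear_extension \<phi> (f i))"
  by (induction I rule: infinite_finite_induct) (simp_all add: linear_extension_add)

lemma poly_mapping_single_induct [case_names zero single add]:
  fixes f :: "'x \<Rightarrow>\<^sub>0 'k::field"
  assumes "P 0" and "\<And>x c. P (Poly_Mapping.single x c)"
    and "\<And>f g. P f \<Longrightarrow> P g \<Longrightarrow> P (f + g)"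
  shows "P f"
proof (induction f rule: update_induct)
  case const
  show ?case by (rule assms)
next
  case (update f a b)
  have "Poly_Mapping.update a b f = Poly_Mapping.single a b + f"
    using update.hyps
    by (intro poly_mapping_eqI)
      (auto simp: lookup_update lookup_add lookup_single when_def in_keys_iff)
  then show ?case using assms update by simp
qed

lemma scale_single [simp]:
  "scale c (Poly_Mapping.single x d) = Poly_Mapping.single x (c * d)"
  by (rule poly_mapping_eqI) (simp add: lookup_scale lookup_single when_def)

lemma linear_extension_scale:
  "linear_extension \<phi> (scale c f) = scale c (linear_extension \<phi> f)"
  by (induction f rule: poly_mapping_single_induct)
    (simp_all add: scale_add linear_extension_add scale_scale)

lemma word_act_add: "word_act E (f + g) w = word_act E f w + word_act E g w"
  by (induction w arbitrary: f g) (simp_all add: word_act_def linear_extension_add)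

lemma word_act_scale:
  "word_act E (scale c f) w = scale c (word_act E f w)"
  by (induction w arbitrary: f) (simp_all add: word_act_def linear_extension_scale)

lemma word_act_zero: "word_act E 0 w = 0"
  using word_act_scale[of E 0 0 w] by simp

lemma word_act_append: "word_act E f (w @ w') = word_act E (word_act E f w) w'"
  by (simp add: word_act_def)

lemma linear_extension_add_fun:
  "linear_extension (\<lambda>x. \<phi> x + \<psi> x) f = linear_extension \<phi> f + linear_extension \<psi> f"
  by (simp add: linear_extension_def scale_add sum.distrib)

lemma free_act_add_left: "free_act E (f + g) a = free_act E f a + free_act E g a"
proof -
  have "word_act E (f + g) = (\<lambda>w. word_act E f w + word_act E g w)"
    by (rule ext) (rule word_act_add)
  then show ?thesis
    by (simp add: free_act_def linear_extension_add_fun)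
qed

lemma free_act_zero_left: "free_act E 0 a = 0"
  using free_act_add_left[of E 0 0 a] by simp

lemma free_act_add_right: "free_act E f (a + b) = free_act E f a + free_act E f b"
  by (simp add: free_act_def linear_extension_add)

lemma free_act_single [simp]:
  "free_act E f (Poly_Mapping.single w c) = scale c (word_act E f w)"
  by (simp add: free_act_def)

lemma free_act_scale:
  "free_act E (scale c f) a = scale c (free_act E f a)"
  by (induction a rule: poly_mapping_single_induct)
    (simp_all add: free_act_add_right scale_add word_act_scale scale_scale mult.commute free_act_def[of _ _ 0])

lemma free_act_mult: "free_act E f (a * b) = free_act E (free_act E f a) b"
proof (induction a rule: poly_mapping_single_induct)
  case zero
  show ?case by (simp add: free_act_def[of _ _ 0] free_act_zero_left)
next
  case (add a a')
  then show ?case by (simp add: distrib_right free_act_add_right free_act_add_left)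
next
  case (single w c)
  show ?case
  proof (induction b rule: poly_mapping_single_induct)
    case zero
    show ?case by (simp add: free_act_def[of _ _ 0])
  next
    case (add b b')
    then show ?case by (simp add: distrib_left free_act_add_right)
  next
    case (single w' c')
    show ?case
      by (simp add: mult_single plus_list_def word_act_append word_act_scale scale_scale mult.commute)
  qed
qed

lemma ring_free_algebra:
  fixes K :: "'k::field itself" and X :: "'x set"
  shows "ring (free_algebra K X)"
proof (rule ringI)
  have uminus: "Poly_Mapping.keys a \<subseteq> lists X \<Longrightarrow> Poly_Mapping.keys (- a) \<subseteq> lists X"
    for a :: "'x list \<Rightarrow>\<^sub>0 'k" by simp
  have plus: "Poly_Mapping.keys a \<subseteq> lists X \<Longrightarrow> Poly_Mapping.keys b \<subseteq> lists X \<Longrightarrow>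
      Poly_Mapping.keys (a + b) \<subseteq> lists X" for a b :: "'x list \<Rightarrow>\<^sub>0 'k"
    using Poly_Mapping.keys_add[of a b] by blast
  show "abelian_group (free_algebra K X)"
  proof (rule abelian_groupI)
    fix x assume "x \<in> carrier (free_algebra K X)"
    then show "\<exists>y \<in> carrier (free_algebra K X).
        y \<oplus>\<^bsub>free_algebra K X\<^esub> x = \<zero>\<^bsub>free_algebra K X\<^esub>"
      by (intro bexI[of _ "- x"]) (simp_all add: free_algebra_def)
  qed (simp_all add: free_algebra_def algebra_simps plus)
  have times: "Poly_Mapping.keys (a * b) \<subseteq> lists X"
    if "Poly_Mapping.keys a \<subseteq> lists X" "Poly_Mapping.keys b \<subseteq> lists X"
    for a b :: "'x list \<Rightarrow>\<^sub>0 'k"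
  proof -
    have "u + v \<in> lists X" if "u \<in> lists X" "v \<in> lists X" for u v :: "'x list"
      using that by (simp add: plus_list_def)
    then show ?thesis using that keys_mult[of a b] by blast
  qed
  show "Group.monoid (free_algebra K X)"
    by (rule monoidI) (simp_all add: free_algebra_def times zero_list_def mult.assoc)
qed (simp_all add: free_algebra_def algebra_simps)

lemma lpa_gens_Vertex: "Vertex v \<in> lpa_gens E \<longleftrightarrow> v \<in> verts E"
  and lpa_gens_Edge: "Edge e \<in> lpa_gens E \<longleftrightarrow> e \<in> arcs E"
  and lpa_gens_Ghost: "Ghost e \<in> lpa_gens E \<longleftrightarrow> e \<in> arcs E"
  by (auto simp: lpa_gens_def)

lemma lpa_relators_nonunital:
  fixes K :: "'k::field itself" and E :: "('v, 'e) pre_digraph"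
  assumes "wf_digraph E"
  shows "lpa_relators K E \<subseteq> nonunital_free_algebra K (lpa_gens E)" (is "_ \<subseteq> ?N")
proof -
  have diff: "a - b \<in> ?N" if "a \<in> ?N" "b \<in> ?N" for a b
    using that keys_diff[of a b] unfolding nonunital_free_algebra_def by blast
  have zero: "0 \<in> ?N"
    by (simp add: nonunital_free_algebra_def)
  have sum: "(\<Sum>e \<in> I. a e) \<in> ?N" if "\<And>e. e \<in> I \<Longrightarrow> a e \<in> ?N" for I :: "'e set" and a
    using that Poly_Mapping.keys_sum[of a I] unfolding nonunital_free_algebra_def by blast
  have word: "word w \<in> ?N" if "w \<noteq> []" "set w \<subseteq> lpa_gens E" for w
    using that by (auto simp: nonunital_free_algebra_def)
  have verts: "e \<in> arcs E \<Longrightarrow> tail E e \<in> verts E" "e \<in> arcs E \<Longrightarrow> head E e \<in> verts E" for e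
    using assms by (simp_all add: wf_digraph_def)
  show ?thesis
    unfolding lpa_relators_def
    by (intro Un_least UN_least subsetI)
      (auto intro!: diff sum word zero simp del: right_minus_eq
        simp: lpa_gens_Vertex lpa_gens_Edge lpa_gens_Ghost out_arcs_def verts)
qed

lemma keys_linear_extension:
  assumes "\<And>x. x \<in> Poly_Mapping.keys f \<Longrightarrow> Poly_Mapping.keys (\<phi> x) \<subseteq> S"
  shows "Poly_Mapping.keys (linear_extension \<phi> f) \<subseteq> S"
proof -
  have "Poly_Mapping.keys (scale c (\<phi> x)) \<subseteq> Poly_Mapping.keys (\<phi> x)" for c x
    by (auto simp: in_keys_iff lookup_scale)
  then show ?thesis
    unfolding linear_extension_def
    using assms Poly_Mapping.keys_sum[of "\<lambda>x. scale (Poly_Mapping.lookup f x) (\<phi> x)" "Poly_Mapping.keys f"]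
    by blast
qed

lemma keys_path_act:
  assumes "q \<in> tail_class E p" "g \<in> lpa_gens E"
  shows "Poly_Mapping.keys (path_act E g q) \<subseteq> tail_class E p"
proof (cases g)
  case (Edge e)
  obtain m n where "sdrop m p = sdrop n q"
    using assms(1) by (auto simp: tail_class_def tail_equivalent_def)
  then have "sdrop (Suc m) p = sdrop n (stl q)"
    by (metis sdrop.simps(2) sdrop_stl)
  moreover have "stl q \<in> infinite_paths E"
    using assms(1) stl_sset[of _ q]
    by (auto simp: tail_class_def infinite_paths_def) (metis snth.simps(2))
  ultimately have "stl q \<in> tail_class E p"
    unfolding tail_class_def tail_equivalent_def by blast
  then show ?thesis
    using Edge by simp
next
  case (Ghost e)
  obtain m n where "sdrop m p = sdrop n q"
    using assms(1) by (auto simp: tail_class_def tail_equivalent_def)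
  then have "sdrop m p = sdrop (Suc n) (e ## q)"
    by simp
  moreover have "e ## q \<in> infinite_paths E" if "head E e = tail E (shd q)"
  proof -
    have "head E ((e ## q) !! i) = tail E ((e ## q) !! Suc i)" for i
      using that assms(1) by (cases i) (auto simp: tail_class_def infinite_paths_def)
    then show ?thesis
      using assms Ghost by (auto simp: tail_class_def infinite_paths_def lpa_gens_def)
  qed
  ultimately have "head E e = tail E (shd q) \<Longrightarrow> e ## q \<in> tail_class E p"
    unfolding tail_class_def tail_equivalent_def by blast
  then show ?thesis
    using Ghost by simp
qed (use assms in auto)

lemma keys_free_act:
  assumes "Poly_Mapping.keys f \<subseteq> tail_class E p" "Poly_Mapping.keys a \<subseteq> lists (lpa_gens E)"
  shows "Poly_Mapping.keys (free_act E f a) \<subseteq> tail_class E p"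
proof -
  have "Poly_Mapping.keys (word_act E f w) \<subseteq> tail_class E p" if "set w \<subseteq> lpa_gens E" for w
    using that assms(1)
  proof (induction w arbitrary: f)
    case Nil
    then show ?case by (simp add: word_act_def)
  next
    case (Cons g w)
    have "Poly_Mapping.keys (linear_extension (path_act E g) f) \<subseteq> tail_class E p"
      by (rule keys_linear_extension) (use Cons.prems in \<open>auto dest!: keys_path_act\<close>)
    then show ?case
      using Cons by (simp add: word_act_def)
  qed
  then show ?thesis
    unfolding free_act_def by (intro keys_linear_extension) (use assms(2) in auto)
qed

lemma word_act_Nil [simp]: "word_act E f [] = f"
  by (simp add: word_act_def)

lemma word_act_Cons [simp]:
  "word_act E f (g # w) = word_act E (linear_extension (path_act E g) f) w"
  by (simp add: word_act_def)

lemma free_act_diff_right: "free_act E f (a - b) = free_act E f a - free_act E f b"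
  by (simp add: free_act_def linear_extension_diff)

lemma free_act_zero_right: "free_act E f 0 = 0"
  by (simp add: free_act_def)

lemma free_act_relator_single:
  assumes "wf_digraph E" "row_finite E" "q \<in> infinite_paths E" "r \<in> lpa_relators K E"
  shows "free_act E (Poly_Mapping.single q 1) r = 0"
proof -
  have q: "shd q \<in> arcs E" "head E (shd q) = tail E (shd (stl q))"
    using assms(3) shd_sset[of q] unfolding infinite_paths_def
    by (auto dest: spec[of _ 0])
  have *: "free_act E (Poly_Mapping.single q 1)
      ((\<Sum>e \<in> out_arcs E v. word [Edge e, Ghost e]) - word [Vertex v]) = 0" if "v \<in> verts E" for v
  proof -
    have fin: "finite (out_arcs E v)" using assms(2) that by (simp add: row_finite_def)
    have "free_act E (Poly_Mapping.single q 1) (\<Sum>e \<in> out_arcs E v. word [Edge e, Ghost e]) =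
        (\<Sum>e \<in> out_arcs E v. if e = shd q then Poly_Mapping.single q 1 else 0)"
      unfolding free_act_def linear_extension_sum
      by (rule sum.cong) (use q in auto)
    also have "\<dots> = (if shd q \<in> out_arcs E v then Poly_Mapping.single q 1 else 0)"
      using fin by simp
    finally show ?thesis
      using q by (auto simp: free_act_diff_right out_arcs_def)
  qed
  consider (CK2) v where "v \<in> verts E"
      "r = (\<Sum>e \<in> out_arcs E v. word [Edge e, Ghost e]) - word [Vertex v]"
    | (vertex) u v where "r = word [Vertex u, Vertex v] - (if u = v then word [Vertex u] else 0)"
    | (edge) e where "r \<in> {word [Vertex (tail E e), Edge e] - word [Edge e],
        word [Edge e, Vertex (head E e)] - word [Edge e],
        word [Vertex (head E e), Ghost e] - word [Ghost e],
        word [Ghost e, Vertex (tail E e)] - word [Ghost e]}"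
    | (CK1) e f where "tail E e = tail E f"
        "r = word [Ghost e, Edge f] - (if e = f then word [Vertex (head E e)] else 0)"
    using assms(4) unfolding lpa_relators_def
    by (elim UnE UN_E CollectE exE conjE)
      (rule that(2), assumption, rule that(3), assumption, rule that(4), assumption, assumption,
        rule that(1), assumption, assumption)
  then show ?thesis
  proof cases
    case CK2
    then show ?thesis using * by simp
  qed (use q in \<open>auto simp: free_act_diff_right free_act_zero_right word_act_zero\<close>)
qed

lemma free_act_relator:
  assumes "wf_digraph E" "row_finite E" "Poly_Mapping.keys f \<subseteq> infinite_paths E"
    and "r \<in> lpa_relators K E"
  shows "free_act E f r = 0"
proof -
  have sum: "free_act E (\<Sum>q \<in> Q. g q) r = (\<Sum>q \<in> Q. free_act E (g q) r)"
    for Q and g :: "_ \<Rightarrow> _"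
    by (induction Q rule: infinite_finite_induct) (simp_all add: free_act_add_left free_act_zero_left)
  have f: "f = (\<Sum>q \<in> Poly_Mapping.keys f. scale (Poly_Mapping.lookup f q) (Poly_Mapping.single q 1))"
    by (intro poly_mapping_eqI)
      (auto simp: lookup_sum lookup_single when_def in_keys_iff)
  have "free_act E f r = (\<Sum>q \<in> Poly_Mapping.keys f.
      free_act E (scale (Poly_Mapping.lookup f q) (Poly_Mapping.single q 1)) r)"
    by (subst f) (rule sum)
  also have "\<dots> = 0"
    by (rule sum.neutral)
      (use assms(3) free_act_relator_single[OF assms(1,2) _ assms(4)] in
        \<open>auto simp del: scale_single simp: free_act_scale\<close>)
  finally show ?thesis .
qed

lemma free_act_ideal:
  assumes "wf_digraph E" "row_finite E" "Poly_Mapping.keys f \<subseteq> tail_class E p"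
    and "a \<in> lpa_ideal K E"
  shows "free_act E f a = 0"
proof -
  let ?A = "free_algebra K (lpa_gens E)"
  let ?J = "{a \<in> carrier ?A. \<forall>f. Poly_Mapping.keys f \<subseteq> tail_class E p \<longrightarrow> free_act E f a = 0}"
  interpret ring ?A by (rule ring_free_algebra)
  have minus: "\<ominus>\<^bsub>?A\<^esub> a = - a" if "a \<in> carrier ?A" for a
  proof (rule minus_equality)
    show "- a \<in> carrier ?A" using that by (simp add: free_algebra_def)
  qed (use that in \<open>simp_all add: free_algebra_def\<close>)
  have "ideal ?J ?A"
  proof (rule idealI[OF ring_axioms])
    show "subgroup ?J (add_monoid ?A)"
    proof (rule add.subgroupI)
      show "?J \<noteq> {}" using zero_closed by (auto simp: free_algebra_def free_act_zero_right intro!: exI[of _ 0])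
    next
      fix a assume a: "a \<in> ?J"
      then have "free_act E f (- a) = 0" if "Poly_Mapping.keys f \<subseteq> tail_class E p" for f
        using that free_act_diff_right[of E f 0 a] by (simp add: free_act_zero_right)
      then show "\<ominus>\<^bsub>?A\<^esub> a \<in> ?J"
        using a minus a_inv_closed[of a] by auto
    next
      fix a b assume ab: "a \<in> ?J" "b \<in> ?J"
      then have "a \<oplus>\<^bsub>?A\<^esub> b \<in> carrier ?A" by simp
      then show "a \<oplus>\<^bsub>?A\<^esub> b \<in> ?J"
        using ab by (simp add: free_algebra_def free_act_add_right)
    qed auto
  next
    fix a x assume ax: "a \<in> ?J" "x \<in> carrier ?A"
    then have "x \<otimes>\<^bsub>?A\<^esub> a \<in> carrier ?A" "a \<otimes>\<^bsub>?A\<^esub> x \<in> carrier ?A" by simp_all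
    then show "x \<otimes>\<^bsub>?A\<^esub> a \<in> ?J" "a \<otimes>\<^bsub>?A\<^esub> x \<in> ?J"
      using ax by (simp_all add: free_algebra_def free_act_mult free_act_zero_left keys_free_act)
  qed
  moreover have "lpa_relators K E \<subseteq> ?J"
  proof
    fix r assume r: "r \<in> lpa_relators K E"
    then have "r \<in> carrier ?A"
      using lpa_relators_nonunital[OF assms(1), of K]
      by (auto simp: free_algebra_def nonunital_free_algebra_def)
    moreover have "free_act E f r = 0" if "Poly_Mapping.keys f \<subseteq> tail_class E p" for f
      by (rule free_act_relator[OF assms(1,2) _ r]) (use that in \<open>auto simp: tail_class_def\<close>)
    ultimately show "r \<in> ?J" by simp
  qed
  ultimately have "lpa_ideal K E \<subseteq> ?J"
    unfolding lpa_ideal_def by (rule genideal_minimal)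
  then show ?thesis using assms(3,4) by blast
qed

lemma ideal_lpa_ideal:
  assumes "wf_digraph E"
  shows "ideal (lpa_ideal K E) (free_algebra K (lpa_gens E))"
proof -
  have "lpa_relators K E \<subseteq> carrier (free_algebra K (lpa_gens E))"
    using lpa_relators_nonunital[OF assms, of K]
    unfolding free_algebra_def nonunital_free_algebra_def ring_record_simps by blast
  then show ?thesis
    unfolding lpa_ideal_def by (rule ring.genideal_ideal[OF ring_free_algebra])
qed

lemma mem_lpa_class: "b \<in> lpa_class K E a \<longleftrightarrow> b - a \<in> lpa_ideal K E"
proof -
  have "b = i + a \<longleftrightarrow> i = b - a" for i
    by (auto simp: algebra_simps)
  then show ?thesis
    by (simp add: lpa_class_def a_r_coset_def' free_algebra_def)
qed

theorem chen_module_act: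
  assumes "wf_digraph E" "row_finite E" "f \<in> carrier (chen_module K E p)"
  shows "f \<cdot>\<^bsub>chen_module K E p\<^esub> lpa_class K E a = free_act E f a"
proof -
  have f: "Poly_Mapping.keys f \<subseteq> tail_class E p"
    using assms(3) by (simp add: chen_module_def)
  have "free_act E f b = free_act E f a" if "b \<in> lpa_class K E a" for b
    using free_act_ideal[OF assms(1,2) f that[unfolded mem_lpa_class]]
    by (simp add: free_act_diff_right)
  moreover have "0 \<in> lpa_ideal K E"
    using additive_subgroup.zero_closed[OF ideal.axioms(1)[OF ideal_lpa_ideal[OF assms(1), of K]]]
    by (simp add: free_algebra_def)
  then have "a \<in> lpa_class K E a"
    by (simp add: mem_lpa_class)
  ultimately have "free_act E f ` lpa_class K E a = {free_act E f a}"
    by blast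
  then show ?thesis by (simp add: chen_module_def)
qed

corollary chen_module_act_generator:
  fixes K :: "'k::field itself"
  assumes "wf_digraph E" "row_finite E" "q \<in> tail_class E p"
  shows "Poly_Mapping.single q 1 \<cdot>\<^bsub>chen_module K E p\<^esub> lpa_class K E (word [g]) = path_act E g q"
proof -
  have "Poly_Mapping.single q 1 \<in> carrier (chen_module K E p)"
    using assms(3) by (simp add: chen_module_def)
  then show ?thesis
    by (simp add: chen_module_act[OF assms(1,2)])
qed

end

theory Submission
  imports Defs
begin

text \<open>Two kinds of words do all the work. The word of the edges of a prefix of \<open>q\<close> sends \<open>q\<close> to
  its tail \<open>sdrop n q\<close> and kills every path with a different prefix of that length; the word of
  the ghosts of a prefix of \<open>r\<close>, read backwards, puts this prefix back in front of the tail.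

  Simplicity: let \<open>f \<noteq> 0\<close> lie in a submodule and let \<open>q\<close> be a path in its support. A prefix of \<open>q\<close>
  long enough to tell \<open>q\<close> from the finitely many other paths in the support turns \<open>f\<close> into a nonzero
  multiple of a tail of \<open>q\<close>. Scaling, cutting off further edges, and adding ghosts, every
  multiple of every path tail-equivalent to \<open>q\<close> is reached from it
  (\<open>submodule_chen_module_generated\<close>).

  Isomorphism: if \<open>p\<close> is not tail-equivalent to \<open>q\<close>, no path in the support of the image of \<open>p\<close>
  is \<open>p\<close> itself, so a long prefix of \<open>p\<close> kills this image. But it does not kill \<open>p\<close>, so the map
  is not injective (\<open>isomorphic_chen_modules_imp\<close>).

  Grading: give \<open>r\<close> the degree \<open>m - n\<close> when \<open>sdrop m p = sdrop n r\<close>. Each path has a unique degree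
  exactly when the tails of \<open>p\<close> are pairwise distinct, that is, when \<open>p\<close> is not eventually periodic,
  and then the spans of the paths of given degree form a grading
  (\<open>graded_chen_module_if_irrational\<close>). If \<open>p\<close> is eventually periodic, some path in its class is
  fixed by an element of positive degree, which shifts its homogeneous components upwards; no
  finite nonempty set of degrees is invariant under such a shift
  (\<open>irrational_if_graded_chen_module\<close>).\<close>

section \<open>Tails and prefixes of infinite paths\<close>

lemma stream_eqI_snth:
  assumes "\<And>i. s !! i = t !! i"
  shows "s = t"
proof -
  have "snth s = snth t"
    by (rule ext) (rule assms)
  then show ?thesis
    by (metis stream_smap_nats)
qed

lemma sdrop_infinite_paths:
  assumes "q \<in> infinite_paths E"
  shows "sdrop n q \<in> infinite_paths E"
proof -
  have "sset (sdrop n q) \<subseteq> sset q"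
    by (auto simp: sset_range sdrop_snth)
  then show ?thesis
    using assms by (auto simp: infinite_paths_def sdrop_snth simp del: sset_range)
qed

lemma infinite_paths_arcs:
  assumes "q \<in> infinite_paths E"
  shows "set (stake n q) \<subseteq> arcs E"
proof -
  have "set (stake n q) \<subseteq> sset q"
    by (metis sset_shift stake_sdrop Un_upper1)
  then show ?thesis
    using assms by (auto simp: infinite_paths_def)
qed

lemma infinite_paths_head_shd:
  assumes "q \<in> infinite_paths E"
  shows "head E (shd q) = tail E (shd (stl q))"
  using assms by (auto simp: infinite_paths_def dest: spec[of _ 0])

lemma tail_equivalent_refl: "tail_equivalent p p"
  unfolding tail_equivalent_def by blast

lemma tail_equivalent_sym: "tail_equivalent p q \<Longrightarrow> tail_equivalent q p"
  unfolding tail_equivalent_def by metis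

lemma tail_equivalent_trans:
  assumes "tail_equivalent p q" "tail_equivalent q r"
  shows "tail_equivalent p r"
proof -
  obtain m n where mn: "sdrop m p = sdrop n q"
    using assms(1) by (auto simp: tail_equivalent_def)
  obtain k l where kl: "sdrop k q = sdrop l r"
    using assms(2) by (auto simp: tail_equivalent_def)
  have "sdrop (m + k) p = sdrop (l + n) r"
    by (metis mn kl sdrop_add add.commute)
  then show ?thesis
    unfolding tail_equivalent_def by blast
qed

lemma tail_class_self: "p \<in> infinite_paths E \<Longrightarrow> p \<in> tail_class E p"
  by (simp add: tail_class_def tail_equivalent_refl)

lemma tail_class_infinite_paths: "q \<in> tail_class E p \<Longrightarrow> q \<in> infinite_paths E"
  by (simp add: tail_class_def)

lemma tail_class_eqI:
  assumes "tail_equivalent p q"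
  shows "tail_class E p = tail_class E q"
  using assms unfolding tail_class_def
  by (blast intro: tail_equivalent_trans tail_equivalent_sym)

lemma sdrop_tail_class:
  assumes "q \<in> tail_class E p"
  shows "sdrop n q \<in> tail_class E p"
proof -
  have "tail_equivalent q (sdrop n q)"
    unfolding tail_equivalent_def by (metis sdrop.simps(1))
  then show ?thesis
    using assms by (auto simp: tail_class_def sdrop_infinite_paths intro: tail_equivalent_trans)
qed

text \<open>Two different streams differ at some position, and finitely many such positions have a
  common bound. This is what turns a combination of paths into a single path: the edges of a long
  prefix act as zero on all paths but one.\<close>

lemma separating_prefix:
  assumes "finite Q" "p \<notin> Q"
  shows "\<exists>n > 0. \<forall>r \<in> Q. stake n r \<noteq> stake n p"
proof -
  have "\<exists>i. r !! i \<noteq> p !! i" if "r \<in> Q" for r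
    using assms(2) that stream_eqI_snth by metis
  then obtain i where i: "\<And>r. r \<in> Q \<Longrightarrow> r !! i r \<noteq> p !! i r"
    by metis
  have "stake (Suc (\<Sum>r \<in> Q. i r)) r \<noteq> stake (Suc (\<Sum>r \<in> Q. i r)) p" if "r \<in> Q" for r
  proof -
    have "i r < Suc (\<Sum>r \<in> Q. i r)"
      using member_le_sum[of r Q i] that assms(1) by simp
    then show ?thesis
      using i[OF that] stake_nth by metis
  qed
  then show ?thesis by blast
qed

text \<open>The equation determines each entry of \<open>s\<close> from \<open>u\<close> or an earlier entry of \<open>s\<close>, and the
  periodic stream satisfies the same equation.\<close>

lemma shift_fixpoint_cycle:
  assumes "u \<noteq> []" "s = u @- s"
  shows "s = cycle u"
proof (rule stream_eqI_snth)
  have step: "t !! i = (if i < length u then u ! i else t !! (i - length u))"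
    if "t = u @- t" for t i
    using that by (metis not_less shift_snth_ge shift_snth_less)
  fix i
  show "s !! i = cycle u !! i"
  proof (induction i rule: less_induct)
    case (less i)
    have "s !! (i - length u) = cycle u !! (i - length u)" if "\<not> i < length u"
      using that assms(1) by (intro less.IH) (cases u, auto)
    then show ?case
      using step[OF assms(2), of i] step[OF cycle_decomp[OF assms(1)], of i] by simp
  qed
qed

lemma cas_stake:
  assumes "q \<in> infinite_paths E"
  shows "pre_digraph.cas E (tail E (shd q)) (stake n q) (tail E (shd (sdrop n q)))"
  using assms
proof (induction n arbitrary: q)
  case 0
  then show ?case by (simp add: pre_digraph.cas.simps)
next
  case (Suc n)
  have "stl q \<in> infinite_paths E"
    using sdrop_infinite_paths[OF Suc.prems, of 1] by simp
  then show ?case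
    using Suc.IH infinite_paths_head_shd[OF Suc.prems]
    by (simp add: pre_digraph.cas.simps del: sdrop_simps)
qed

text \<open>A path is rational exactly when it is eventually periodic; a repetition \<open>sdrop a p = sdrop b p\<close> with
  \<open>a < b\<close> is the same as a period \<open>b - a\<close> of the tail \<open>sdrop a p\<close>, which then runs around the
  closed path formed by its first \<open>b - a\<close> edges. In this form rationality no longer mentions
  cycles.\<close>

lemma rational_path_iff:
  assumes "wf_digraph E" "p \<in> infinite_paths E"
  shows "rational_path E p \<longleftrightarrow> (\<exists>a k. k > 0 \<and> sdrop (a + k) p = sdrop a p)"
proof
  assume "rational_path E p"
  then obtain c m n where c: "c \<noteq> []" and mn: "sdrop m p = sdrop n (cycle c)"
    by (auto simp: rational_path_def cyclic_path_def tail_equivalent_def)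
  have "sdrop (m + length c) p = sdrop (n + length c) (cycle c)"
    by (metis mn sdrop_add)
  also have "\<dots> = sdrop n (cycle c)"
    by (metis c sdrop_add sdrop_cycle_eq add.commute)
  finally show "\<exists>a k. k > 0 \<and> sdrop (a + k) p = sdrop a p"
    using c mn by (metis length_greater_0_conv)
next
  assume "\<exists>a k. k > 0 \<and> sdrop (a + k) p = sdrop a p"
  then obtain a k where k: "k > 0" "sdrop (a + k) p = sdrop a p"
    by blast
  define q where "q = sdrop a p"
  have q: "q \<in> infinite_paths E" "sdrop k q = q"
    using k assms(2) by (simp_all add: q_def sdrop_infinite_paths)
  have "q = stake k q @- q"
    by (metis q(2) stake_sdrop)
  then have cycle: "q = cycle (stake k q)"
    by (rule shift_fixpoint_cycle[rotated]) (use k(1) in simp)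
  have "pre_digraph.awalk E (tail E (shd q)) (stake k q) (tail E (shd q))"
    unfolding pre_digraph.awalk_def
  proof (intro conjI)
    show "set (stake k q) \<subseteq> arcs E"
      by (rule infinite_paths_arcs[OF q(1)])
    then show "tail E (shd q) \<in> verts E"
      using assms(1) infinite_paths_arcs[OF q(1), of 1] by (simp add: wf_digraph_def)
    show "pre_digraph.cas E (tail E (shd q)) (stake k q) (tail E (shd q))"
      using cas_stake[OF q(1), of k] q(2) by simp
  qed
  then have "cyclic_path E q"
    unfolding cyclic_path_def using cycle k(1) by (metis stake_invert_Nil not_less0)
  moreover have "tail_equivalent p q"
    unfolding tail_equivalent_def q_def by (metis sdrop.simps(1))
  ultimately show "rational_path E p"
    using assms(2) by (auto simp: rational_path_def)
qed


section \<open>Words that move paths\<close>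

lemma single_eq_0_iff: "Poly_Mapping.single x c = 0 \<longleftrightarrow> c = 0"
  by (metis keys_eq_empty keys_single insert_not_empty single_zero)

lemma word_act_sum: "word_act E (\<Sum>i \<in> I. f i) w = (\<Sum>i \<in> I. word_act E (f i) w)"
  by (induction I rule: infinite_finite_induct) (simp_all add: word_act_add word_act_zero)

lemma poly_mapping_eq_sum_singles:
  fixes f :: "'x \<Rightarrow>\<^sub>0 'k::field"
  shows "f = (\<Sum>q \<in> Poly_Mapping.keys f. Poly_Mapping.single q (Poly_Mapping.lookup f q))"
  by (intro poly_mapping_eqI) (auto simp: lookup_sum lookup_single when_def in_keys_iff)

lemma word_act_edges:
  "word_act E (Poly_Mapping.single r c) (map Edge u) =
     (if stake (length u) r = u then Poly_Mapping.single (sdrop (length u) r) c else 0)"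
  by (induction u arbitrary: r) (auto simp: word_act_zero)

lemma word_act_edges_prefix:
  "word_act E (Poly_Mapping.single q c) (map Edge (stake n q)) =
     Poly_Mapping.single (sdrop n q) c"
  by (simp add: word_act_edges)

lemma word_act_edges_eq_0:
  assumes "\<And>r. r \<in> Poly_Mapping.keys f \<Longrightarrow> stake n r \<noteq> stake n q"
  shows "word_act E f (map Edge (stake n q)) = 0"
proof -
  have "word_act E f (map Edge (stake n q)) =
      (\<Sum>r \<in> Poly_Mapping.keys f.
        word_act E (Poly_Mapping.single r (Poly_Mapping.lookup f r)) (map Edge (stake n q)))"
    by (subst poly_mapping_eq_sum_singles[of f]) (rule word_act_sum)
  also have "\<dots> = 0"
    by (rule sum.neutral) (use assms in \<open>auto simp: word_act_edges\<close>)
  finally show ?thesis .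
qed

text \<open>The reversal is due to the action being from the right: the edge next to the tail is attached
  first. The path condition on \<open>r\<close> ensures that none of these steps gives zero.\<close>

lemma word_act_ghosts:
  assumes "r \<in> infinite_paths E"
  shows "word_act E (Poly_Mapping.single (sdrop n r) c) (map Ghost (rev (stake n r))) =
           Poly_Mapping.single r c"
  using assms
proof (induction n arbitrary: r)
  case 0
  then show ?case by simp
next
  case (Suc n)
  have "stl r \<in> infinite_paths E"
    using sdrop_infinite_paths[OF Suc.prems, of 1] by simp
  then show ?case
    using Suc.IH infinite_paths_head_shd[OF Suc.prems]
    by (simp add: word_act_append)
qed

text \<open>The Leavitt path algebra consists of the classes of combinations of nonempty words, hence the
  requirement of positive length.\<close>

lemma word_edges_nonunital:
  assumes "q \<in> infinite_paths E" "n > 0"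
  shows "Poly_Mapping.single (map Edge (stake n q)) c \<in> nonunital_free_algebra K (lpa_gens E)"
  using infinite_paths_arcs[OF assms(1), of n] assms(2)
  by (simp add: nonunital_free_algebra_def lpa_gens_Edge subset_iff in_lists_conv_set)

lemma word_ghosts_nonunital:
  assumes "q \<in> infinite_paths E" "n > 0"
  shows "Poly_Mapping.single (map Ghost (rev (stake n q))) c
           \<in> nonunital_free_algebra K (lpa_gens E)"
  using infinite_paths_arcs[OF assms(1), of n] assms(2)
  by (simp add: nonunital_free_algebra_def lpa_gens_Ghost subset_iff in_lists_conv_set)


section \<open>Chen modules as modules over the Leavitt path algebra\<close>

lemma chen_module_simps [simp]:
  "carrier (chen_module K E p) = {f. Poly_Mapping.keys f \<subseteq> tail_class E p}"
  "zero (chen_module K E p) = 0"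
  "add (chen_module K E p) = (+)"
  by (simp_all add: chen_module_def)

lemma carrier_leavitt_path_algebra:
  "carrier (leavitt_path_algebra K E) = lpa_class K E ` nonunital_free_algebra K (lpa_gens E)"
  by (simp add: leavitt_path_algebra_def)

lemma nonunital_free_algebra_subset:
  "nonunital_free_algebra K X \<subseteq> carrier (free_algebra K X)"
  by (auto simp: nonunital_free_algebra_def free_algebra_def)

lemma lpa_class_add:
  assumes "wf_digraph E" "a \<in> nonunital_free_algebra K (lpa_gens E)"
    "b \<in> nonunital_free_algebra K (lpa_gens E)"
  shows "lpa_class K E a \<oplus>\<^bsub>leavitt_path_algebra K E\<^esub> lpa_class K E b = lpa_class K E (a + b)"
proof -
  interpret ideal "lpa_ideal K E" "free_algebra K (lpa_gens E)"
    by (rule ideal_lpa_ideal[OF assms(1)])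
  have "a \<in> carrier (free_algebra K (lpa_gens E))" "b \<in> carrier (free_algebra K (lpa_gens E))"
    using assms(2,3) nonunital_free_algebra_subset by blast+
  from a_rcos_sum[OF this] show ?thesis
    by (simp add: leavitt_path_algebra_def FactRing_def lpa_class_def) (simp add: free_algebra_def)
qed

lemma lpa_class_mult:
  assumes "wf_digraph E" "a \<in> nonunital_free_algebra K (lpa_gens E)"
    "b \<in> nonunital_free_algebra K (lpa_gens E)"
  shows "lpa_class K E a \<otimes>\<^bsub>leavitt_path_algebra K E\<^esub> lpa_class K E b = lpa_class K E (a * b)"
proof -
  interpret ideal "lpa_ideal K E" "free_algebra K (lpa_gens E)"
    by (rule ideal_lpa_ideal[OF assms(1)])
  have "a \<in> carrier (free_algebra K (lpa_gens E))" "b \<in> carrier (free_algebra K (lpa_gens E))"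
    using assms(2,3) nonunital_free_algebra_subset by blast+
  from rcoset_mult_add[OF this] show ?thesis
    by (simp add: leavitt_path_algebra_def FactRing_def lpa_class_def) (simp add: free_algebra_def)
qed

lemma abelian_group_chen_module:
  fixes K :: "'k::field itself"
  shows "abelian_group (chen_module K E p)"
proof (rule abelian_groupI)
  fix f g :: "_ \<Rightarrow>\<^sub>0 'k"
  assume fg: "f \<in> carrier (chen_module K E p)" "g \<in> carrier (chen_module K E p)"
  then show "f \<oplus>\<^bsub>chen_module K E p\<^esub> g \<in> carrier (chen_module K E p)"
    using Poly_Mapping.keys_add[of f g] by auto
  show "\<exists>h \<in> carrier (chen_module K E p). h \<oplus>\<^bsub>chen_module K E p\<^esub> f = \<zero>\<^bsub>chen_module K E p\<^esub>"
    using fg by (intro bexI[of _ "- f"]) auto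
qed (auto simp: algebra_simps)

lemma additive_subgroup_chen_module:
  fixes K :: "'k::field itself"
  assumes "S \<subseteq> tail_class E p"
  shows "additive_subgroup {f :: _ \<Rightarrow>\<^sub>0 'k. Poly_Mapping.keys f \<subseteq> S} (chen_module K E p)"
proof -
  interpret abelian_group "chen_module K E p"
    by (rule abelian_group_chen_module)
  have minus: "\<ominus>\<^bsub>chen_module K E p\<^esub> f = - f" if "Poly_Mapping.keys f \<subseteq> S" for f
    by (rule minus_equality) (use that assms in auto)
  show ?thesis
  proof (intro additive_subgroup.intro add.subgroupI)
    show "{f. Poly_Mapping.keys f \<subseteq> S} \<noteq> {}"
      by (auto intro!: exI[of _ 0])
  next
    fix f g :: "_ \<Rightarrow>\<^sub>0 'k"
    assume "f \<in> {f. Poly_Mapping.keys f \<subseteq> S}" "g \<in> {f. Poly_Mapping.keys f \<subseteq> S}"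
    then show "f \<oplus>\<^bsub>chen_module K E p\<^esub> g \<in> {f. Poly_Mapping.keys f \<subseteq> S}"
      using Poly_Mapping.keys_add[of f g] by auto
  qed (use assms minus in auto)
qed

lemma finsum_chen_module:
  assumes "finite I" "\<And>i. i \<in> I \<Longrightarrow> f i \<in> carrier (chen_module K E p)"
  shows "(\<Oplus>\<^bsub>chen_module K E p\<^esub>i \<in> I. f i) = (\<Sum>i \<in> I. f i)"
proof -
  interpret abelian_group "chen_module K E p"
    by (rule abelian_group_chen_module)
  show ?thesis
    using assms
  proof (induction I)
    case (insert i I)
    then have "(\<Oplus>\<^bsub>chen_module K E p\<^esub>i \<in> insert i I. f i) =
        f i \<oplus>\<^bsub>chen_module K E p\<^esub> (\<Oplus>\<^bsub>chen_module K E p\<^esub>i \<in> I. f i)"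
      by (intro finsum_insert) auto
    then show ?case using insert by simp
  qed simp
qed

lemma right_module_chen_module:
  assumes "wf_digraph E" "row_finite E"
  shows "right_module (leavitt_path_algebra K E) (chen_module K E p)"
proof -
  let ?L = "leavitt_path_algebra K E" and ?M = "chen_module K E p"
  let ?N = "nonunital_free_algebra K (lpa_gens E)"
  note act = chen_module_act[OF assms]
  have closed: "free_act E f a \<in> carrier ?M" if "f \<in> carrier ?M" "a \<in> ?N" for f a
    using that keys_free_act[of f E p a] by (auto simp: nonunital_free_algebra_def)
  have add: "f + g \<in> carrier ?M" if "f \<in> carrier ?M" "g \<in> carrier ?M" for f g
    using that Poly_Mapping.keys_add[of f g] by auto
  show ?thesis
  proof (intro right_module.intro right_module_axioms.intro abelian_group_chen_module)
    fix f A assume "f \<in> carrier ?M" "A \<in> carrier ?L"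
    then show "f \<cdot>\<^bsub>?M\<^esub> A \<in> carrier ?M"
      using closed by (auto simp: act carrier_leavitt_path_algebra simp del: chen_module_simps(1))
  next
    fix f g A assume "f \<in> carrier ?M" "g \<in> carrier ?M" "A \<in> carrier ?L"
    then show "(f \<oplus>\<^bsub>?M\<^esub> g) \<cdot>\<^bsub>?M\<^esub> A = f \<cdot>\<^bsub>?M\<^esub> A \<oplus>\<^bsub>?M\<^esub> g \<cdot>\<^bsub>?M\<^esub> A"
      using add
      by (auto simp: act carrier_leavitt_path_algebra free_act_add_left simp del: chen_module_simps(1))
  next
    fix f A B assume f: "f \<in> carrier ?M" and "A \<in> carrier ?L" "B \<in> carrier ?L"
    then obtain a b where "a \<in> ?N" "b \<in> ?N" "A = lpa_class K E a" "B = lpa_class K E b"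
      by (auto simp: carrier_leavitt_path_algebra)
    then show "f \<cdot>\<^bsub>?M\<^esub> (A \<oplus>\<^bsub>?L\<^esub> B) = f \<cdot>\<^bsub>?M\<^esub> A \<oplus>\<^bsub>?M\<^esub> f \<cdot>\<^bsub>?M\<^esub> B"
      "f \<cdot>\<^bsub>?M\<^esub> (A \<otimes>\<^bsub>?L\<^esub> B) = f \<cdot>\<^bsub>?M\<^esub> A \<cdot>\<^bsub>?M\<^esub> B"
      using f closed
      by (simp_all add: act lpa_class_add[OF assms(1)] lpa_class_mult[OF assms(1)]
          free_act_add_right free_act_mult del: chen_module_simps(1))
  qed
qed


section \<open>Simplicity\<close>

text \<open>A submodule is only known to be closed under addition and under the algebra. Closure under
  scalars comes from putting the scalar into the coefficient of the acting word, which is why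
  arbitrary coefficients \<open>d\<close> are carried along.\<close>

lemma submodule_chen_module_generated:
  fixes K :: "'k::field itself" and E :: "('v, 'e) pre_digraph"
  assumes "wf_digraph E" "row_finite E"
    and "submodule (leavitt_path_algebra K E) (chen_module K E p) N"
    and "f \<in> N" "f \<noteq> 0"
  shows "N = carrier (chen_module K E p)"
proof -
  let ?M = "chen_module K E p"
  let ?S = "Poly_Mapping.single :: 'e stream \<Rightarrow> 'k \<Rightarrow> _"
  interpret N: additive_subgroup N ?M
    using assms(3) by (simp add: submodule_def)
  have N_sub: "N \<subseteq> carrier ?M"
    by (rule N.a_subset)
  have act: "free_act E g a \<in> N"
    if "g \<in> N" "a \<in> nonunital_free_algebra K (lpa_gens E)" for g a
  proof -
    have "g \<cdot>\<^bsub>?M\<^esub> lpa_class K E a \<in> N"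
      using assms(3) that by (auto simp: submodule_def carrier_leavitt_path_algebra)
    then show ?thesis
      using chen_module_act[OF assms(1,2)] that(1) N_sub by (metis subsetD)
  qed
  have "Poly_Mapping.keys f \<noteq> {}"
    using assms(5) by simp
  then obtain q where q: "q \<in> Poly_Mapping.keys f"
    by blast
  then have q_class: "q \<in> tail_class E p"
    using N_sub assms(4) by auto
  then have q_path: "q \<in> infinite_paths E"
    by (rule tail_class_infinite_paths)
  obtain n where n: "n > 0" "\<And>r. r \<in> Poly_Mapping.keys f - {q} \<Longrightarrow> stake n r \<noteq> stake n q"
    using separating_prefix[of "Poly_Mapping.keys f - {q}" q] by auto
  define c where "c = Poly_Mapping.lookup f q"
  have c: "c \<noteq> 0"
    using q by (simp add: c_def in_keys_iff)
  have rest: "Poly_Mapping.keys (f - ?S q c) \<subseteq> Poly_Mapping.keys f - {q}"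
    by (auto simp: in_keys_iff lookup_minus lookup_single c_def when_def split: if_splits)
  have "word_act E f (map Edge (stake n q)) =
      word_act E (?S q c + (f - ?S q c)) (map Edge (stake n q))"
    by simp
  also have "\<dots> = ?S (sdrop n q) c"
    unfolding word_act_add
    using rest n(2) by (subst (2) word_act_edges_eq_0) (auto simp: word_act_edges_prefix)
  finally have cut: "word_act E f (map Edge (stake n q)) = ?S (sdrop n q) c" .
  \<comment> \<open>Acting by \<open>d / c\<close> times the word replaces the coefficient \<open>c\<close> of \<open>q\<close> by \<open>d\<close>.\<close>
  have tail: "?S (sdrop n q) d \<in> N" for d
    using act[OF assms(4) word_edges_nonunital[OF q_path n(1), of "d * inverse c"]] cut c
    by (simp add: mult.assoc)
  have single: "?S r d \<in> N" if r: "r \<in> tail_class E p" for r d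
  proof -
    have "tail_equivalent (sdrop n q) r"
      using r sdrop_tail_class[OF q_class, of n] tail_equivalent_trans tail_equivalent_sym
      unfolding tail_class_def by blast
    then obtain k l where "sdrop k (sdrop n q) = sdrop l r"
      by (auto simp: tail_equivalent_def)
    \<comment> \<open>One step further along the tails, so that both words used below are nonempty.\<close>
    then have kl: "sdrop (Suc k) (sdrop n q) = sdrop (Suc l) r"
      by (metis sdrop_simps(2))
    have r_path: "r \<in> infinite_paths E"
      using r by (rule tail_class_infinite_paths)
    have "free_act E (?S (sdrop n q) d) (word (map Edge (stake (Suc k) (sdrop n q)))) =
        ?S (sdrop (Suc k) (sdrop n q)) d"
      by (simp only: free_act_single scale_1 word_act_edges_prefix)
    then have "?S (sdrop (Suc l) r) d \<in> N"
      using act[OF tail[of d] word_edges_nonunital[OF sdrop_infinite_paths[OF q_path, of n] zero_less_Suc[of k], of 1]] kl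
      by metis
    from act[OF this word_ghosts_nonunital[OF r_path zero_less_Suc[of l], of 1]]
    show ?thesis
      by (simp only: free_act_single scale_1 word_act_ghosts[OF r_path])
  qed
  have sums: "(\<Sum>r \<in> R. g r) \<in> N" if "\<And>r. r \<in> R \<Longrightarrow> g r \<in> N" for R and g :: "'e stream \<Rightarrow> _"
    using that N.zero_closed N.a_closed
    by (induction R rule: infinite_finite_induct) auto
  have "g \<in> N" if "Poly_Mapping.keys g \<subseteq> tail_class E p" for g
    by (subst poly_mapping_eq_sum_singles, rule sums, rule single) (use that in auto)
  then show ?thesis
    using N_sub by auto
qed

lemma chen_module_act_word:
  assumes "wf_digraph E" "row_finite E" "f \<in> carrier (chen_module K E p)"
  shows "f \<cdot>\<^bsub>chen_module K E p\<^esub> lpa_class K E (word w) = word_act E f w"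
  using chen_module_act[OF assms] by simp

lemma simple_chen_module:
  fixes K :: "'k::field itself" and E :: "('v, 'e) pre_digraph"
  assumes "wf_digraph E" "row_finite E" "p \<in> infinite_paths E"
  shows "simple_module (leavitt_path_algebra K E) (chen_module K E p)"
  unfolding simple_module_def
proof (intro conjI allI impI right_module_chen_module assms)
  let ?L = "leavitt_path_algebra K E" and ?M = "chen_module K E p"
  let ?w = "word (map Edge (stake 1 p)) :: _ \<Rightarrow>\<^sub>0 'k"
  have p: "Poly_Mapping.single p 1 \<in> carrier ?M"
    using tail_class_self[OF assms(3)] by simp
  have "lpa_class K E ?w \<in> carrier ?L"
    unfolding carrier_leavitt_path_algebra
    by (rule imageI, rule word_edges_nonunital) (use assms(3) in auto)
  moreover have "Poly_Mapping.single p 1 \<cdot>\<^bsub>?M\<^esub> lpa_class K E ?w \<noteq> \<zero>\<^bsub>?M\<^esub>"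
    unfolding chen_module_act_word[OF assms(1,2) p] word_act_edges_prefix
    by (simp add: single_eq_0_iff)
  ultimately show "\<exists>x \<in> carrier ?M. \<exists>a \<in> carrier ?L. x \<cdot>\<^bsub>?M\<^esub> a \<noteq> \<zero>\<^bsub>?M\<^esub>"
    using p by blast
  fix N assume N: "submodule ?L ?M N"
  then have "0 \<in> N"
    using additive_subgroup.zero_closed[of N ?M] by (simp add: submodule_def)
  then show "N = {\<zero>\<^bsub>?M\<^esub>} \<or> N = carrier ?M"
    using submodule_chen_module_generated[OF assms(1,2) N] by auto
qed


section \<open>The tail class as an isomorphism invariant\<close>

text \<open>Whatever kills the image of \<open>p\<close> under an injective module map kills \<open>p\<close>, while \<open>p\<close> survives
  each of its own prefixes. So the image must have \<open>p\<close> in its support.\<close>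

lemma isomorphic_chen_modules_imp:
  fixes K :: "'k::field itself" and E :: "('v, 'e) pre_digraph"
  assumes "wf_digraph E" "row_finite E" "p \<in> infinite_paths E"
    and "isomorphic_modules (leavitt_path_algebra K E) (chen_module K E p) (chen_module K E q)"
  shows "tail_class E p = tail_class E q"
proof (rule ccontr)
  assume ne: "tail_class E p \<noteq> tail_class E q"
  let ?M = "chen_module K E p" and ?M' = "chen_module K E q"
  obtain \<phi> where iso: "\<phi> \<in> iso (add_monoid ?M) (add_monoid ?M')"
    and \<phi>: "\<And>f A. f \<in> carrier ?M \<Longrightarrow> A \<in> carrier (leavitt_path_algebra K E) \<Longrightarrow>
      \<phi> (f \<cdot>\<^bsub>?M\<^esub> A) = \<phi> f \<cdot>\<^bsub>?M'\<^esub> A"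
    using assms(4) unfolding isomorphic_modules_def by blast
  have inj: "inj_on \<phi> (carrier ?M)" and into: "\<And>f. f \<in> carrier ?M \<Longrightarrow> \<phi> f \<in> carrier ?M'"
    and hom: "\<And>f g. f \<in> carrier ?M \<Longrightarrow> g \<in> carrier ?M \<Longrightarrow> \<phi> (f + g) = \<phi> f + \<phi> g"
    using iso by (auto simp: iso_def hom_def bij_betw_def)
  have zero: "\<phi> 0 = 0"
    using hom[of 0 0] by simp
  let ?p = "Poly_Mapping.single p (1 :: 'k)"
  have p: "?p \<in> carrier ?M"
    using tail_class_self[OF assms(3)] by simp
  have "p \<notin> Poly_Mapping.keys (\<phi> ?p)"
  proof
    assume "p \<in> Poly_Mapping.keys (\<phi> ?p)"
    then have "tail_equivalent q p"
      using into[OF p] by (auto simp: tail_class_def)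
    then show False
      using ne tail_class_eqI by metis
  qed
  then obtain n where n: "n > 0"
    "\<And>r. r \<in> Poly_Mapping.keys (\<phi> ?p) \<Longrightarrow> stake n r \<noteq> stake n p"
    using separating_prefix[of "Poly_Mapping.keys (\<phi> ?p)" p] by auto
  define A where "A = lpa_class K E (word (map Edge (stake n p)))"
  have A: "A \<in> carrier (leavitt_path_algebra K E)"
    unfolding A_def carrier_leavitt_path_algebra
    by (rule imageI, rule word_edges_nonunital[OF assms(3) n(1)])
  have "\<phi> (?p \<cdot>\<^bsub>?M\<^esub> A) = 0"
    unfolding \<phi>[OF p A] unfolding A_def chen_module_act_word[OF assms(1,2) into[OF p]]
    by (rule word_act_edges_eq_0) (rule n(2))
  moreover have pA: "?p \<cdot>\<^bsub>?M\<^esub> A = Poly_Mapping.single (sdrop n p) 1"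
    unfolding A_def chen_module_act_word[OF assms(1,2) p] word_act_edges_prefix ..
  moreover have "Poly_Mapping.single (sdrop n p) (1 :: 'k) \<in> carrier ?M"
    using sdrop_tail_class[OF tail_class_self[OF assms(3)]] by simp
  ultimately have "Poly_Mapping.single (sdrop n p) (1 :: 'k) = 0"
    using inj_onD[OF inj, of _ 0] zero by simp
  then show False
    by (simp add: single_eq_0_iff)
qed

lemma isomorphic_chen_modules_iff:
  fixes K :: "'k::field itself" and E :: "('v, 'e) pre_digraph"
  assumes "wf_digraph E" "row_finite E" "p \<in> infinite_paths E"
  shows "isomorphic_modules (leavitt_path_algebra K E) (chen_module K E p) (chen_module K E q)
    \<longleftrightarrow> tail_class E p = tail_class E q"
proof
  assume "tail_class E p = tail_class E q"
  then have eq: "chen_module K E q = chen_module K E p"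
    by (simp add: chen_module_def)
  have "id \<in> iso (add_monoid (chen_module K E p)) (add_monoid (chen_module K E p))"
    by (simp add: iso_def hom_def)
  then show "isomorphic_modules (leavitt_path_algebra K E) (chen_module K E p) (chen_module K E q)"
    unfolding isomorphic_modules_def eq using right_module_chen_module[OF assms(1,2)]
    by (metis id_apply)
qed (rule isomorphic_chen_modules_imp[OF assms])


section \<open>Gradings and periodicity\<close>

text \<open>The edges of \<open>p\<close> up to position \<open>m\<close>, followed by the ghosts of the edges of \<open>r\<close> from
  position \<open>n\<close> backwards, carry \<open>p\<close> to \<open>r\<close> and have degree \<open>m - n\<close>. So in a grading with \<open>p\<close> in
  degree 0, the path \<open>r\<close> must have this degree. For rational \<open>p\<close> the sets below overlap.\<close>

definition degree_class :: "('v, 'e) pre_digraph \<Rightarrow> 'e stream \<Rightarrow> int \<Rightarrow> 'e stream set" where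
  "degree_class E p d =
     {r \<in> infinite_paths E. \<exists>m n. sdrop m p = sdrop n r \<and> int m - int n = d}"

lemma degree_class_subset: "degree_class E p d \<subseteq> tail_class E p"
  by (auto simp: degree_class_def tail_class_def tail_equivalent_def)

lemma tail_class_degree_class: "r \<in> tail_class E p \<Longrightarrow> \<exists>d. r \<in> degree_class E p d"
  by (auto simp: degree_class_def tail_class_def tail_equivalent_def)

text \<open>Two degrees for the same path \<open>r\<close> would make two different tails of \<open>p\<close> equal.\<close>

lemma degree_class_unique:
  assumes "wf_digraph E" "irrational_path E p"
    and "r \<in> degree_class E p d" "r \<in> degree_class E p d'"
  shows "d = d'"
proof -
  obtain m n where mn: "sdrop m p = sdrop n r" "int m - int n = d"
    using assms(3) by (auto simp: degree_class_def)
  obtain m' n' where mn': "sdrop m' p = sdrop n' r" "int m' - int n' = d'"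
    using assms(4) by (auto simp: degree_class_def)
  have p: "p \<in> infinite_paths E" "\<not> rational_path E p"
    using assms(2) by (simp_all add: irrational_path_def)
  have inj: "a = b" if "sdrop a p = sdrop b p" "a \<le> b" for a b
    using p(2) that unfolding rational_path_iff[OF assms(1) p(1)]
    by (metis le_add_diff_inverse diff_is_0_eq neq0_conv le_antisym)
  have "sdrop (m + n') p = sdrop (n + n') r" "sdrop (m' + n) p = sdrop (n' + n) r"
    by (metis mn(1) sdrop_add, metis mn'(1) sdrop_add)
  then have "sdrop (m + n') p = sdrop (m' + n) p"
    by (simp add: add.commute)
  then have "m + n' = m' + n"
    by (metis inj nat_le_linear)
  then show ?thesis
    using mn(2) mn'(2) by simp
qed

lemma keys_path_act_degree:
  assumes "r \<in> degree_class E p d" "g \<in> lpa_gens E"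
  shows "Poly_Mapping.keys (path_act E g r) \<subseteq> degree_class E p (d + gen_degree g)"
proof -
  obtain m n where mn: "sdrop m p = sdrop n r" "int m - int n = d"
    using assms(1) by (auto simp: degree_class_def)
  have inf: "s \<in> infinite_paths E" if "s \<in> Poly_Mapping.keys (path_act E g r)" for s
    using keys_path_act[OF subsetD[OF degree_class_subset assms(1)] assms(2)] that
    by (auto intro: tail_class_infinite_paths)
  show ?thesis
  proof
    fix s assume s: "s \<in> Poly_Mapping.keys (path_act E g r)"
    have "\<exists>m n. sdrop m p = sdrop n s \<and> int m - int n = d + gen_degree g"
    proof (cases g)
      case (Vertex v)
      then show ?thesis
        using s mn by (auto split: if_splits)
    next
      case (Edge e)
      have "sdrop (Suc m) p = sdrop n (stl r)"
        by (metis mn(1) sdrop_simps(2) sdrop_stl)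
      then show ?thesis
        using Edge s mn(2) by (intro exI[of _ "Suc m"] exI[of _ n]) (auto split: if_splits)
    next
      case (Ghost e)
      have "sdrop m p = sdrop (Suc n) (e ## r)"
        by (simp add: mn(1))
      then show ?thesis
        using Ghost s mn(2) by (intro exI[of _ m] exI[of _ "Suc n"]) (auto split: if_splits)
    qed
    then show "s \<in> degree_class E p (d + gen_degree g)"
      using inf[OF s] by (simp add: degree_class_def)
  qed
qed

lemma keys_word_act_degree:
  assumes "Poly_Mapping.keys f \<subseteq> degree_class E p d" "set w \<subseteq> lpa_gens E"
  shows "Poly_Mapping.keys (word_act E f w)
           \<subseteq> degree_class E p (d + sum_list (map gen_degree w))"
  using assms
proof (induction w arbitrary: f d)
  case (Cons g w)
  have "Poly_Mapping.keys (linear_extension (path_act E g) f) \<subseteq> degree_class E p (d + gen_degree g)"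
    by (rule keys_linear_extension) (use Cons.prems keys_path_act_degree in fastforce)
  from Cons.IH[OF this] show ?case
    using Cons.prems by (simp add: add.assoc)
qed simp

text \<open>By uniqueness of degrees, the component of \<open>f\<close> in degree \<open>d\<close> can only be the restriction of \<open>f\<close>
  to the paths of degree \<open>d\<close>.\<close>

lemma graded_chen_module_if_irrational:
  fixes K :: "'k::field itself" and E :: "('v, 'e) pre_digraph"
  assumes "wf_digraph E" "row_finite E" "irrational_path E p"
  shows "graded_module (leavitt_path_algebra K E) (lpa_component K E) (chen_module K E p)"
proof -
  let ?M = "chen_module K E p"
  define V where "V d = {f :: 'e stream \<Rightarrow>\<^sub>0 'k. Poly_Mapping.keys f \<subseteq> degree_class E p d}" for d
  have V_sub: "f \<in> carrier ?M" if "f \<in> V d" for f d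
    using that degree_class_subset[of E p d] by (auto simp: V_def)
  obtain deg where deg: "\<And>r. r \<in> tail_class E p \<Longrightarrow> r \<in> degree_class E p (deg r)"
    using tail_class_degree_class by metis
  have deg_eq: "d = deg r" if "r \<in> degree_class E p d" for r d
    using degree_class_unique[OF assms(1,3) that deg] degree_class_subset that by blast
  have decomposition: "\<exists>!h. (\<forall>d. h d \<in> V d) \<and> finite {d. h d \<noteq> \<zero>\<^bsub>?M\<^esub>} \<and>
      f = (\<Oplus>\<^bsub>?M\<^esub>d \<in> {d. h d \<noteq> \<zero>\<^bsub>?M\<^esub>}. h d)" if f: "f \<in> carrier ?M" for f
  proof (rule ex1I)
    let ?S = "Poly_Mapping.single :: 'e stream \<Rightarrow> 'k \<Rightarrow> _"
    define h where "h d = (\<Sum>r \<in> {r \<in> Poly_Mapping.keys f. deg r = d}. ?S r (Poly_Mapping.lookup f r))" for d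
    have lookup_h: "Poly_Mapping.lookup (h d) r = (if deg r = d then Poly_Mapping.lookup f r else 0)" for d r
      by (auto simp: h_def lookup_sum lookup_single when_def in_keys_iff)
    have V: "h d \<in> V d" for d
    proof -
      have "r \<in> degree_class E p d" if r: "Poly_Mapping.lookup (h d) r \<noteq> 0" for r
      proof -
        have "r \<in> Poly_Mapping.keys f" "deg r = d"
          using r by (auto simp: lookup_h in_keys_iff split: if_splits)
        then show ?thesis
          using f deg[of r] by auto
      qed
      then show ?thesis
        by (auto simp: V_def in_keys_iff)
    qed
    have supp: "{d. h d \<noteq> 0} \<subseteq> deg ` Poly_Mapping.keys f"
    proof
      fix d assume "d \<in> {d. h d \<noteq> 0}"
      then obtain r where "Poly_Mapping.lookup (h d) r \<noteq> 0"
        using poly_mapping_eqI[of "h d" 0] by auto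
      then show "d \<in> deg ` Poly_Mapping.keys f"
        by (auto simp: lookup_h in_keys_iff split: if_splits)
    qed
    then have fin: "finite {d. h d \<noteq> 0}"
      by (rule finite_subset) simp
    have "(\<Oplus>\<^bsub>?M\<^esub>d \<in> {d. h d \<noteq> 0}. h d) = (\<Sum>d \<in> {d. h d \<noteq> 0}. h d)"
      by (rule finsum_chen_module[OF fin V_sub[OF V]])
    also have "\<dots> = f"
    proof (rule poly_mapping_eqI)
      fix r
      have "h (deg r) \<noteq> 0" if "Poly_Mapping.lookup f r \<noteq> 0"
        using that lookup_h[of "deg r" r] by auto
      then show "Poly_Mapping.lookup (\<Sum>d \<in> {d. h d \<noteq> 0}. h d) r = Poly_Mapping.lookup f r"
        using fin by (auto simp: lookup_sum lookup_h)
    qed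
    finally show "(\<forall>d. h d \<in> V d) \<and> finite {d. h d \<noteq> \<zero>\<^bsub>?M\<^esub>} \<and>
        f = (\<Oplus>\<^bsub>?M\<^esub>d \<in> {d. h d \<noteq> \<zero>\<^bsub>?M\<^esub>}. h d)"
      using V fin by simp
    fix g
    assume g: "(\<forall>d. g d \<in> V d) \<and> finite {d. g d \<noteq> \<zero>\<^bsub>?M\<^esub>} \<and>
        f = (\<Oplus>\<^bsub>?M\<^esub>d \<in> {d. g d \<noteq> \<zero>\<^bsub>?M\<^esub>}. g d)"
    then have V_g: "\<And>d. g d \<in> V d" and fin_g: "finite {d. g d \<noteq> 0}"
      by simp_all
    have f_eq: "f = (\<Sum>d \<in> {d. g d \<noteq> 0}. g d)"
      using g finsum_chen_module[OF fin_g V_sub[OF V_g]] by simp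
    have g_off: "Poly_Mapping.lookup (g d) r = 0" if "deg r \<noteq> d" for d r
      using V_g[of d] deg_eq[of r d] that by (auto simp: V_def in_keys_iff)
    have "Poly_Mapping.lookup f r = Poly_Mapping.lookup (g (deg r)) r" for r
    proof -
      have "Poly_Mapping.lookup f r =
          (\<Sum>d \<in> {d. g d \<noteq> 0}. if d = deg r then Poly_Mapping.lookup (g (deg r)) r else 0)"
        unfolding f_eq lookup_sum by (rule sum.cong) (auto simp: g_off)
      then show ?thesis
        using fin_g by auto
    qed
    then show "g = h"
      by (intro ext poly_mapping_eqI) (auto simp: lookup_h g_off)
  qed
  have action: "f \<cdot>\<^bsub>?M\<^esub> A \<in> V (d + e)" if f: "f \<in> V d" and A: "A \<in> lpa_component K E e" for f A d e
  proof -
    obtain a where a: "A = lpa_class K E a" "a \<in> nonunital_free_algebra K (lpa_gens E)"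
      "\<And>w. w \<in> Poly_Mapping.keys a \<Longrightarrow> sum_list (map gen_degree w) = e"
      using A by (auto simp: lpa_component_def)
    have "Poly_Mapping.keys (word_act E f w) \<subseteq> degree_class E p (d + e)"
      if "w \<in> Poly_Mapping.keys a" for w
      using keys_word_act_degree[of f E p d w] f a(2) a(3)[OF that] that
      by (auto simp: V_def nonunital_free_algebra_def)
    then have "Poly_Mapping.keys (free_act E f a) \<subseteq> degree_class E p (d + e)"
      unfolding free_act_def by (rule keys_linear_extension)
    then show ?thesis
      by (simp add: a(1) V_def chen_module_act[OF assms(1,2) V_sub[OF f]])
  qed
  have "additive_subgroup (V d) ?M" for d
    unfolding V_def by (rule additive_subgroup_chen_module[OF degree_class_subset])
  then show ?thesis
    unfolding graded_module_def
    using right_module_chen_module[OF assms(1,2)] decomposition action by blast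
qed

text \<open>If \<open>p\<close> is rational, some tail \<open>q\<close> of \<open>p\<close> is fixed by a word \<open>c\<close> of degree \<open>k > 0\<close>. In a
  grading, acting by \<open>c\<close> shifts the homogeneous components of \<open>q\<close> by \<open>k\<close> and must reproduce them,
  so there is no lowest one.\<close>

lemma irrational_if_graded_chen_module:
  fixes K :: "'k::field itself" and E :: "('v, 'e) pre_digraph"
  assumes "wf_digraph E" "row_finite E" "p \<in> infinite_paths E"
    and "graded_module (leavitt_path_algebra K E) (lpa_component K E) (chen_module K E p)"
  shows "irrational_path E p"
proof (rule ccontr)
  let ?M = "chen_module K E p"
  assume "\<not> irrational_path E p"
  then obtain a k where k: "k > 0" "sdrop (a + k) p = sdrop a p"
    using rational_path_iff[OF assms(1,3)] assms(3) by (auto simp: irrational_path_def)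
  define q where "q = sdrop a p"
  have q: "q \<in> infinite_paths E" "q \<in> tail_class E p" "sdrop k q = q"
    using k(2) assms(3) by (simp_all add: q_def sdrop_infinite_paths sdrop_tail_class tail_class_self)
  let ?q = "Poly_Mapping.single q (1 :: 'k)"
  have q_carrier: "?q \<in> carrier ?M"
    using q(2) by simp
  define c where "c = (map Edge (stake k q) :: ('v, 'e) lpa_gen list)"
  define A where "A = lpa_class K E (word c)"
  have "sum_list (map gen_degree c) = int k"
    by (simp add: c_def comp_def sum_list_triv)
  then have A: "A \<in> lpa_component K E (int k)"
    unfolding lpa_component_def A_def
    using word_edges_nonunital[OF q(1) k(1), of 1 K] by (auto simp: c_def)
  have qc: "word_act E ?q c = ?q"
    by (simp add: c_def word_act_edges_prefix q(3))
  obtain V where sub: "\<forall>n. additive_subgroup (V n) ?M"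
    and dec: "\<forall>x \<in> carrier ?M. \<exists>!f. (\<forall>n. f n \<in> V n) \<and> finite {n. f n \<noteq> \<zero>\<^bsub>?M\<^esub>} \<and>
            x = (\<Oplus>\<^bsub>?M\<^esub>n \<in> {n. f n \<noteq> \<zero>\<^bsub>?M\<^esub>}. f n)"
    and act: "\<forall>n m. \<forall>x \<in> V n. \<forall>B \<in> lpa_component K E m. x \<cdot>\<^bsub>?M\<^esub> B \<in> V (n + m)"
    using assms(4) unfolding graded_module_def
    by (elim conjE exE) (rule that; assumption)
  have V_sub: "x \<in> carrier ?M" if "x \<in> V n" for x n
    using additive_subgroup.a_subset[OF sub[rule_format, of n]] that by blast
  have V_c: "word_act E x c \<in> V (n + int k)" if "x \<in> V n" for x n
    using act[rule_format, OF that A] chen_module_act_word[OF assms(1,2) V_sub[OF that]]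
    by (simp add: A_def)
  define decomposes where "decomposes f \<longleftrightarrow> (\<forall>n. f n \<in> V n) \<and> finite {n. f n \<noteq> 0} \<and>
      ?q = (\<Sum>n \<in> {n. f n \<noteq> 0}. f n)" for f
  have unique: "\<exists>!f. decomposes f"
  proof -
    have "decomposes f \<longleftrightarrow> (\<forall>n. f n \<in> V n) \<and> finite {n. f n \<noteq> \<zero>\<^bsub>?M\<^esub>} \<and>
            ?q = (\<Oplus>\<^bsub>?M\<^esub>n \<in> {n. f n \<noteq> \<zero>\<^bsub>?M\<^esub>}. f n)" for f
      using finsum_chen_module[of "{n. f n \<noteq> 0}" f K E p] V_sub
      unfolding decomposes_def chen_module_simps(2) by metis
    then show ?thesis
      using dec[rule_format, OF q_carrier] by presburger
  qed
  then obtain f where f: "decomposes f"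
    by blast
  define S where "S = {n. f n \<noteq> 0}"
  have fS: "\<And>n. f n \<in> V n" "finite S" "?q = (\<Sum>n \<in> S. f n)"
    using f by (auto simp: decomposes_def S_def)
  \<comment> \<open>The components of \<open>q\<close> after acting by \<open>c\<close>, which fixes \<open>q\<close>.\<close>
  define g where "g n = word_act E (f (n - int k)) c" for n
  have "decomposes g"
    unfolding decomposes_def
  proof (intro conjI allI)
    show "g n \<in> V n" for n
      using V_c[OF fS(1)[of "n - int k"]] by (simp add: g_def)
    have supp: "{n. g n \<noteq> 0} \<subseteq> (\<lambda>n. n + int k) ` S"
    proof
      fix n assume "n \<in> {n. g n \<noteq> 0}"
      then have "n - int k \<in> S"
        by (auto simp: g_def S_def word_act_zero)
      then show "n \<in> (\<lambda>n. n + int k) ` S"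
        by (intro image_eqI[of _ _ "n - int k"]) simp_all
    qed
    then show "finite {n. g n \<noteq> 0}"
      using fS(2) finite_surj by blast
    have "(\<Sum>n \<in> {n. g n \<noteq> 0}. g n) = (\<Sum>n \<in> (\<lambda>n. n + int k) ` S. g n)"
      by (rule sum.mono_neutral_left) (use fS(2) supp in auto)
    also have "\<dots> = (\<Sum>n \<in> S. word_act E (f n) c)"
      by (subst sum.reindex) (simp_all add: g_def inj_on_def)
    also have "\<dots> = ?q"
      using qc fS(3) word_act_sum[of E f S c] by simp
    finally show "?q = (\<Sum>n \<in> {n. g n \<noteq> 0}. g n)" ..
  qed
  then have "f = g"
    using f unique by blast
  have "S \<noteq> {}"
    using fS(3) by (auto simp: single_eq_0_iff)
  then have "Min S \<in> S"
    using fS(2) by simp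
  \<comment> \<open>A nonzero component in degree \<open>n\<close> comes from a nonzero component in degree \<open>n - k\<close>.\<close>
  then have "Min S - int k \<in> S"
    using fun_cong[OF \<open>f = g\<close>, of "Min S"] by (auto simp: S_def g_def word_act_zero)
  then show False
    using Min_le[OF fS(2), of "Min S - int k"] k(1) by simp
qed

theorem theorem51:
  fixes K :: "'k::field itself" and E :: "('v, 'e) pre_digraph" and p q :: "'e stream"
  assumes "wf_digraph E" and "row_finite E"
    and "p \<in> infinite_paths E" and "q \<in> infinite_paths E"
  shows
    "simple_module (leavitt_path_algebra K E) (chen_module K E p) \<and>
     (isomorphic_modules (leavitt_path_algebra K E) (chen_module K E p) (chen_module K E q)
        \<longleftrightarrow> tail_class E p = tail_class E q) \<and>
     (graded_module (leavitt_path_algebra K E) (lpa_component K E) (chen_module K E p)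
        \<longleftrightarrow> irrational_path E p)"
  using simple_chen_module[OF assms(1-3)] isomorphic_chen_modules_iff[OF assms(1-3)]
    graded_chen_module_if_irrational[OF assms(1,2)] irrational_if_graded_chen_module[OF assms(1-3)]
  by blast

end
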